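(* Let $\mathbf{k}$ be a commutative unitary ring and $\lambda\in\mathbf{k}$. Let $(\mathbf{k}\,\mathcal{F},\diamond,P_{\mathcal F})$ be the Rota--Baxter algebra of planar rooted forests of weight $\lambda$, and let $\mathcal{F}^0\subseteq\mathcal{F}$ be the set of ladder-free forests. Then the submodule $\mathbf{k}\,\mathcal{F}^0$ of $\mathbf{k}\,\mathcal{F}$ is a nonunitary Rota--Baxter subalgebra of $\mathbf{k}\,\mathcal{F}$ under the product $\diamond$ (with Rota--Baxter operator the restriction of $P_{\mathcal F}$).
   Context: Rota--Baxter algebra of weight $\lambda$: an associative $\mathbf{k}$-algebra $R$ with a $\mathbf{k}$-linear map $P:R\to R$ such that $P(x)P(y)=P\big(P(x)y+xP(y)+\lambda xy\big)$ for all $x,y\in R$. "Nonunitary" means not required to have (or to share) an identity element; a nonunitary Rota--Baxter subalgebra is a submodule closed under the product and under the operator. Forests: $\mathcal{T}$ is the set of planar rooted trees; $\bullet$ is the tree with a single vertex. $\mathcal{F}$ is the free semigroup generated by $\mathcal{T}$, with product (concatenation) denoted $\sqcup$; its elements $T_1\sqcup\cdots\sqcup T_b$ ($b\ge 1$, $T_i\in\mathcal{T}$) are called planar rooted forests. The grafting $\lfloor T_1\sqcup\cdots\sqcup T_b\rfloor$ is the tree obtained by adding a new root together with an edge from the new root to the root of each $T_i$ (keeping the order). Every tree is either $\bullet$ or of the form $\lfloor \overline{F}\rfloor$ for a unique forest $\overline{F}$. The depth of a tree is the length of the longest path from its root to a leaf; the depth $\mathrm{d}(F)$ of a forest is the maximal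 depth of its trees. The product $\sqcup$ and the grafting $\lfloor\ \rfloor$ are extended (bi)linearly to $\mathbf{k}\,\mathcal{F}$, the free $\mathbf{k}$-module on $\mathcal F$. Product $\diamond$: it is defined on $\mathcal{F}\times\mathcal{F}$ with values in $\mathbf{k}\,\mathcal{F}$ by induction on $\mathrm{d}(F)+\mathrm{d}(F')$ and extended bilinearly. For trees $F,F'$: $F\diamond\bullet=F$, $\bullet\diamond F'=F'$, and if $F=\lfloor\overline{F}\rfloor$, $F'=\lfloor\overline{F}'\rfloor$ then $$F\diamond F'=\lfloor\lfloor\overline{F}\rfloor\diamond\overline{F}'\rfloor+\lfloor\overline{F}\diamond\lfloor\overline{F}'\rfloor\rfloor+\lambda\lfloor\overline{F}\diamond\overline{F}'\rfloor .$$ For forests $F=T_1\sqcup\cdots\sqcup T_b$ and $F'=T'_1\sqcup\cdots\sqcup T'_{b'}$, $F\diamond F'=T_1\sqcup\cdots\sqcup T_{b-1}\sqcup(T_b\diamond T'_1)\sqcup T'_2\sqcup\cdots\sqcup T'_{b'}$. Operator: $P_{\mathcal F}(F)=\lfloor F\rfloor$, extended linearly. Ladder-free forests: $\mathcal{F}^0$ is the set of forests $F\in\mathcal{F}$ with $F\ne\bullet$ such that $F$ does not contain the subtree $\lfloor\bullet\rfloor$, i.e. when $F$ is written in terms of $\bullet$, $\sqcup$ and brackets, none of the brackets $\lfloor B\rfloor$ occurring in $F$ is $\lfloor\bullet\rfloor$ (equivalently, no vertex of $F$ has exactly one child with that child a leaf). *)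

theory Defs
  imports Complex_Main "HOL-Library.Poly_Mapping"
begin

section \<open>Rota--Baxter algebras\<close>

text \<open>Algebras are associative but not required to have an identity element.\<close>

locale rota_baxter_algebra = module scale
  for scale :: "'k::comm_ring_1 \<Rightarrow> 'a::ab_group_add \<Rightarrow> 'a" +
  fixes mult :: "'a \<Rightarrow> 'a \<Rightarrow> 'a"
    and P :: "'a \<Rightarrow> 'a"
    and lam :: 'k
  assumes mult_assoc: "mult (mult x y) z = mult x (mult y z)"
    and mult_linear_left: "module_hom scale scale (\<lambda>x. mult x y)"
    and mult_linear_right: "module_hom scale scale (mult x)"
    and P_linear: "module_hom scale scale P"
    and rota_baxter:
      "mult (P x) (P y) = P (mult (P x) y + mult x (P y) + scale lam (mult x y))"

locale nonunitary_rota_baxter_subalgebra = rota_baxter_algebra scale mult P lam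
  for scale :: "'k::comm_ring_1 \<Rightarrow> 'a::ab_group_add \<Rightarrow> 'a"
    and mult :: "'a \<Rightarrow> 'a \<Rightarrow> 'a"
    and P :: "'a \<Rightarrow> 'a"
    and lam :: 'k +
  fixes S :: "'a set"
  assumes subspace: "subspace S"
    and mult_closed: "x \<in> S \<Longrightarrow> y \<in> S \<Longrightarrow> mult x y \<in> S"
    and P_closed: "x \<in> S \<Longrightarrow> P x \<in> S"


section \<open>Planar rooted forests\<close>

text \<open>
  Forests are nonempty sequences of trees, i.e. elements of the free semigroup on the trees.
  A tree \<open>T\<close>, regarded as a forest, is \<open>Single T\<close>.
\<close>

datatype tree = Bullet | Graft forest
  and forest = Single tree | Cons tree forest

lemma size_forest_pos [simp]: "0 < size (F :: forest)"
  by (cases F) simp_all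

primrec forest_append :: "forest \<Rightarrow> forest \<Rightarrow> forest" where
  "forest_append (Single T) G = Cons T G"
| "forest_append (Cons T F) G = Cons T (forest_append F G)"

primrec has_ladder_tree :: "tree \<Rightarrow> bool" and has_ladder :: "forest \<Rightarrow> bool" where
  "has_ladder_tree Bullet \<longleftrightarrow> False"
| "has_ladder_tree (Graft F) \<longleftrightarrow> F = Single Bullet \<or> has_ladder F"
| "has_ladder (Single T) \<longleftrightarrow> has_ladder_tree T"
| "has_ladder (Cons T F) \<longleftrightarrow> has_ladder_tree T \<or> has_ladder F"

definition ladder_free_forests :: "forest set" where
  "ladder_free_forests = {F. F \<noteq> Single Bullet \<and> \<not> has_ladder F}"


section \<open>Free modules\<close>

text \<open>The free module on \<open>'b\<close> is the type of finitely supported functions \<open>'b \<Rightarrow>\<^sub>0 'k\<close>.\<close>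

definition fm_scale :: "'k::comm_ring_1 \<Rightarrow> ('b \<Rightarrow>\<^sub>0 'k) \<Rightarrow> ('b \<Rightarrow>\<^sub>0 'k)" where
  "fm_scale c x = Poly_Mapping.map ((*) c) x"

definition basis :: "'b \<Rightarrow> ('b \<Rightarrow>\<^sub>0 'k::comm_ring_1)" where
  "basis b = Poly_Mapping.single b 1"

definition linear_extension ::
    "('b \<Rightarrow> ('c \<Rightarrow>\<^sub>0 'k)) \<Rightarrow> ('b \<Rightarrow>\<^sub>0 'k) \<Rightarrow> ('c \<Rightarrow>\<^sub>0 'k::comm_ring_1)" where
  "linear_extension f x = (\<Sum>b\<in>Poly_Mapping.keys x. fm_scale (Poly_Mapping.lookup x b) (f b))"

definition bilinear_extension ::
    "('b \<Rightarrow> 'c \<Rightarrow> ('d \<Rightarrow>\<^sub>0 'k)) \<Rightarrow> ('b \<Rightarrow>\<^sub>0 'k) \<Rightarrow> ('c \<Rightarrow>\<^sub>0 'k) \<Rightarrow> ('d \<Rightarrow>\<^sub>0 'k::comm_ring_1)"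
  where
  "bilinear_extension f x y = linear_extension (\<lambda>b. linear_extension (f b) y) x"

text \<open>The submodule of elements supported in \<open>B\<close>, i.e. the free module on \<open>B\<close>.\<close>

definition free_submodule :: "'b set \<Rightarrow> ('b \<Rightarrow>\<^sub>0 'k::comm_ring_1) set" where
  "free_submodule B = {x. Poly_Mapping.keys x \<subseteq> B}"


section \<open>The Rota--Baxter structure on planar rooted forests\<close>

definition graft :: "(forest \<Rightarrow>\<^sub>0 'k::comm_ring_1) \<Rightarrow> (forest \<Rightarrow>\<^sub>0 'k)" where
  "graft = linear_extension (\<lambda>F. basis (Single (Graft F)))"

text \<open>
  In the product of two forests only the last tree of the first factor and the first tree of the
  second factor interact. The last two equations strip off the remaining trees one side at a time.
\<close>

function (sequential) diamond_basis ::
    "'k::comm_ring_1 \<Rightarrow> forest \<Rightarrow> forest \<Rightarrow> (forest \<Rightarrow>\<^sub>0 'k)" where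
  "diamond_basis lam (Single T) (Single Bullet) = basis (Single T)"
| "diamond_basis lam (Single Bullet) (Single T) = basis (Single T)"
| "diamond_basis lam (Single (Graft F)) (Single (Graft G)) =
     graft (diamond_basis lam (Single (Graft F)) G)
     + graft (diamond_basis lam F (Single (Graft G)))
     + fm_scale lam (graft (diamond_basis lam F G))"
| "diamond_basis lam (Single T) (Cons U G) =
     linear_extension (\<lambda>X. basis (forest_append X G)) (diamond_basis lam (Single T) (Single U))"
| "diamond_basis lam (Cons T F) G =
     linear_extension (\<lambda>X. basis (Cons T X)) (diamond_basis lam F G)"
  by pat_completeness auto
termination
  by (relation "measure (\<lambda>(lam, F, G). size F + size G)") auto

definition diamond ::
    "'k::comm_ring_1 \<Rightarrow> (forest \<Rightarrow>\<^sub>0 'k) \<Rightarrow> (forest \<Rightarrow>\<^sub>0 'k) \<Rightarrow> (forest \<Rightarrow>\<^sub>0 'k)" where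
  "diamond lam = bilinear_extension (diamond_basis lam)"


section \<open>Planar rooted forests form a Rota--Baxter algebra\<close>

lemma lookup_fm_scale [simp]: "Poly_Mapping.lookup (fm_scale c x) b = c * Poly_Mapping.lookup x b"
  by (simp add: fm_scale_def Poly_Mapping.map.rep_eq when_def)

lemma module_fm_scale: "module fm_scale"
  by unfold_locales (auto intro!: poly_mapping_eqI simp: lookup_add algebra_simps)

interpretation fm: module fm_scale
  by (rule module_fm_scale)

lemma linear_extension_superset:
  assumes "finite A" "Poly_Mapping.keys x \<subseteq> A"
  shows "linear_extension f x = (\<Sum>b\<in>A. fm_scale (Poly_Mapping.lookup x b) (f b))"
  unfolding linear_extension_def
  by (rule sum.mono_neutral_left) (use assms in \<open>auto simp: in_keys_iff\<close>)

lemma linear_extension_basis [simp]: "linear_extension f (basis b) = f b"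
  by (simp add: linear_extension_def basis_def)

lemma linear_extension_add [simp]:
  "linear_extension f (x + y) = linear_extension f x + linear_extension f y"
proof -
  let ?A = "Poly_Mapping.keys x \<union> Poly_Mapping.keys y"
  have "Poly_Mapping.keys (x + y) \<subseteq> ?A"
    by (rule keys_add)
  then show ?thesis
    by (simp add: linear_extension_superset[of ?A] lookup_add fm.scale_left_distrib sum.distrib)
qed

lemma linear_extension_scale [simp]:
  "linear_extension f (fm_scale c x) = fm_scale c (linear_extension f x)"
proof -
  have "Poly_Mapping.keys (fm_scale c x) \<subseteq> Poly_Mapping.keys x"
    by (auto simp: in_keys_iff)
  then show ?thesis
    by (simp add: linear_extension_superset[of "Poly_Mapping.keys x"] fm.scale_sum_right)
qed

lemma linear_extension_0 [simp]: "linear_extension f 0 = 0"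
  by (simp add: linear_extension_def)

lemma linear_extension_sum:
  "linear_extension f (sum g A) = (\<Sum>a\<in>A. linear_extension f (g a))"
  by (induction A rule: infinite_finite_induct) auto

lemma linear_extension_linear_extension:
  "linear_extension f (linear_extension g x) = linear_extension (\<lambda>b. linear_extension f (g b)) x"
  unfolding linear_extension_def[of g x] linear_extension_def[of _ x]
  by (simp add: linear_extension_sum)

lemma linear_extension_add_fun:
  "linear_extension (\<lambda>b. f b + g b) x = linear_extension f x + linear_extension g x"
  by (simp add: linear_extension_def fm.scale_right_distrib sum.distrib)

lemma linear_extension_scale_fun:
  "linear_extension (\<lambda>b. fm_scale c (f b)) x = fm_scale c (linear_extension f x)"
  by (simp add: linear_extension_def fm.scale_sum_right mult.commute)

lemma linear_extension_id [simp]: "linear_extension basis x = x"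
proof (rule poly_mapping_eqI)
  fix b
  show "Poly_Mapping.lookup (linear_extension basis x) b = Poly_Mapping.lookup x b"
    by (simp add: linear_extension_def basis_def lookup_sum lookup_single when_def
        in_keys_iff if_distrib cong: if_cong)
qed

lemma linear_extension_linear: "module_hom fm_scale fm_scale (linear_extension f)"
  by unfold_locales auto

lemma linear_extension_swap:
  "linear_extension (\<lambda>b. linear_extension (f b) y) x
   = linear_extension (\<lambda>c. linear_extension (\<lambda>b. f b c) x) y"
proof -
  have "linear_extension (\<lambda>b. linear_extension (f b) y) x =
      (\<Sum>b\<in>Poly_Mapping.keys x. \<Sum>c\<in>Poly_Mapping.keys y.
         fm_scale (Poly_Mapping.lookup x b * Poly_Mapping.lookup y c) (f b c))"
    by (simp add: linear_extension_def fm.scale_sum_right)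
  also have "\<dots> = (\<Sum>c\<in>Poly_Mapping.keys y. \<Sum>b\<in>Poly_Mapping.keys x.
         fm_scale (Poly_Mapping.lookup x b * Poly_Mapping.lookup y c) (f b c))"
    by (rule sum.swap)
  also have "\<dots> = linear_extension (\<lambda>c. linear_extension (\<lambda>b. f b c) x) y"
    by (simp add: linear_extension_def fm.scale_sum_right mult.commute)
  finally show ?thesis .
qed

lemma graft_simps [simp]:
  "graft (basis F) = basis (Single (Graft F))"
  "graft (x + y) = graft x + graft y"
  "graft (fm_scale c x) = fm_scale c (graft x)"
  by (simp_all add: graft_def)

lemma forest_append_assoc [simp]:
  "forest_append (forest_append F G) H = forest_append F (forest_append G H)"
  by (induction F) auto

text \<open>Together, the next two lemmas give the product of arbitrary forests in terms of trees.\<close>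

lemma diamond_basis_append_left:
  "diamond_basis lam (forest_append F G) H =
     linear_extension (\<lambda>X. basis (forest_append F X)) (diamond_basis lam G H)"
  by (induction F) (simp_all add: linear_extension_linear_extension)

lemma diamond_basis_append_right:
  "diamond_basis lam F (forest_append G H) =
     linear_extension (\<lambda>X. basis (forest_append X H)) (diamond_basis lam F G)"
proof (induction F rule: forest.induct[of "\<lambda>_. True"])
  case (Single T)
  show ?case
    by (cases G) (simp_all add: linear_extension_linear_extension)
next
  case (Cons T F)
  then show ?case
    by (simp add: linear_extension_linear_extension)
qed auto

lemma diamond_Bullet_left [simp]: "diamond_basis lam (Single Bullet) F = basis F"
proof (cases F)
  case (Single T)
  then show ?thesis by (cases T) simp_all
next
  case (Cons T F')
  then show ?thesis by (cases T) simp_all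
qed

lemma diamond_Bullet_right [simp]: "diamond_basis lam F (Single Bullet) = basis F"
  by (induction F) simp_all

lemma diamond_simps:
  "diamond lam (basis F) (basis G) = diamond_basis lam F G"
  "diamond lam (x + y) z = diamond lam x z + diamond lam y z"
  "diamond lam x (y + z) = diamond lam x y + diamond lam x z"
  "diamond lam (fm_scale c x) y = fm_scale c (diamond lam x y)"
  "diamond lam x (fm_scale c y) = fm_scale c (diamond lam x y)"
  by (simp_all add: diamond_def bilinear_extension_def linear_extension_add_fun
      linear_extension_scale_fun)

lemma diamond_linear_extension_left:
  "diamond lam (linear_extension f x) z = linear_extension (\<lambda>b. diamond lam (f b) z) x"
  by (simp add: diamond_def bilinear_extension_def linear_extension_linear_extension)

lemma diamond_linear_extension_right:
  "diamond lam x (linear_extension f z) = linear_extension (\<lambda>b. diamond lam x (f b)) z"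
  unfolding diamond_def bilinear_extension_def linear_extension_linear_extension
  by (rule linear_extension_swap)

lemma diamond_eq_left:
  "diamond lam x z = linear_extension (\<lambda>b. diamond lam (basis b) z) x"
  by (metis diamond_linear_extension_left linear_extension_id)

lemma diamond_eq_right:
  "diamond lam x z = linear_extension (\<lambda>b. diamond lam x (basis b)) z"
  by (metis diamond_linear_extension_right linear_extension_id)

lemma diamond_append_left:
  "diamond lam (linear_extension (\<lambda>X. basis (forest_append F X)) x) z =
     linear_extension (\<lambda>X. basis (forest_append F X)) (diamond lam x z)"
proof -
  have "diamond lam (basis (forest_append F X)) z =
      linear_extension (\<lambda>X. basis (forest_append F X)) (diamond lam (basis X) z)" for X
    unfolding diamond_eq_right[of _ _ z]
    by (simp add: diamond_simps(1) diamond_basis_append_left linear_extension_linear_extension)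
  then show ?thesis
    unfolding diamond_linear_extension_left diamond_eq_left[of _ x]
    by (simp add: linear_extension_linear_extension)
qed

lemma diamond_append_right:
  "diamond lam x (linear_extension (\<lambda>X. basis (forest_append X H)) z) =
     linear_extension (\<lambda>X. basis (forest_append X H)) (diamond lam x z)"
proof -
  have "diamond lam x (basis (forest_append X H)) =
      linear_extension (\<lambda>X. basis (forest_append X H)) (diamond lam x (basis X))" for X
    unfolding diamond_eq_left[of _ x]
    by (simp add: diamond_simps(1) diamond_basis_append_right linear_extension_linear_extension)
  then show ?thesis
    unfolding diamond_linear_extension_right diamond_eq_right[of _ _ z]
    by (simp add: linear_extension_linear_extension)
qed

lemma diamond_graft:
  "diamond lam (graft x) (graft y) =
     graft (diamond lam (graft x) y + diamond lam x (graft y) + fm_scale lam (diamond lam x y))"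
proof -
  have 1: "diamond lam (graft (basis F)) (graft (basis G)) =
     graft (diamond lam (graft (basis F)) (basis G) + diamond lam (basis F) (graft (basis G))
       + fm_scale lam (diamond lam (basis F) (basis G)))" for F G
    by (simp add: diamond_simps(1))
  have lin: "graft (linear_extension f z) = linear_extension (\<lambda>b. graft (f b)) z"
    for f and z :: "forest \<Rightarrow>\<^sub>0 'a"
    by (simp add: graft_def linear_extension_linear_extension)
  have 2: "diamond lam (graft (basis F)) (graft (linear_extension basis y)) =
     graft (diamond lam (graft (basis F)) (linear_extension basis y)
       + diamond lam (basis F) (graft (linear_extension basis y))
       + fm_scale lam (diamond lam (basis F) (linear_extension basis y)))" for F
    unfolding lin diamond_linear_extension_right 1
    by (simp add: linear_extension_add_fun linear_extension_scale_fun lin del: linear_extension_id)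
  have "diamond lam (graft (linear_extension basis x)) (graft y) =
     graft (diamond lam (graft (linear_extension basis x)) y
       + diamond lam (linear_extension basis x) (graft y)
       + fm_scale lam (diamond lam (linear_extension basis x) y))"
    unfolding lin diamond_linear_extension_left 2[unfolded linear_extension_id]
    by (simp add: linear_extension_add_fun linear_extension_scale_fun lin del: linear_extension_id)
  then show ?thesis by simp
qed

lemma diamond_basis_assoc:
  "diamond lam (diamond_basis lam F G) (basis H) = diamond lam (basis F) (diamond_basis lam G H)"
proof (induction "size F + size G + size H" arbitrary: F G H rule: less_induct)
  case less
  note IH = less.hyps
  have Cons_eq: "Cons T X = forest_append (Single T) X" for T X
    by simp
  consider T F' where "F = Cons T F'"
    | T H' where "H = Cons T H'"
    | T G' where "G = Cons T G'"
    | "F = Single Bullet \<or> G = Single Bullet \<or> H = Single Bullet"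
    | f g h where "F = Single (Graft f)" "G = Single (Graft g)" "H = Single (Graft h)"
    by (metis forest.exhaust tree.exhaust)
  then show ?case
  proof cases
    case (1 T F')
    have "diamond lam (diamond_basis lam F' G) (basis H)
        = diamond lam (basis F') (diamond_basis lam G H)"
      by (rule IH) (simp add: 1)
    then show ?thesis
      using diamond_append_left[of lam "Single T" "diamond_basis lam F' G" "basis H"]
        diamond_append_left[of lam "Single T" "basis F'" "diamond_basis lam G H"]
      by (simp add: 1)
  next
    case (2 T H')
    have "diamond lam (diamond_basis lam F G) (basis (Single T))
        = diamond lam (basis F) (diamond_basis lam G (Single T))"
      by (rule IH) (simp add: 2)
    then show ?thesis
      using diamond_append_right[of lam "diamond_basis lam F G" H' "basis (Single T)"]
        diamond_append_right[of lam "basis F" H' "diamond_basis lam G (Single T)"]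
        diamond_basis_append_right[of lam G "Single T" H']
      by (simp add: 2)
  next
    case (3 T G')
    have g1: "diamond lam (basis (forest_append X G')) (basis H) =
        linear_extension (\<lambda>Y. basis (forest_append X Y)) (diamond_basis lam G' H)" for X
      by (simp add: diamond_simps diamond_basis_append_left)
    have g2: "diamond lam (basis F) (basis (forest_append (Single T) Y)) =
        linear_extension (\<lambda>X. basis (forest_append X Y)) (diamond_basis lam F (Single T))" for Y
      unfolding diamond_simps by (rule diamond_basis_append_right)
    have g3: "diamond_basis lam F G =
        linear_extension (\<lambda>X. basis (forest_append X G')) (diamond_basis lam F (Single T))"
      using diamond_basis_append_right[of lam F "Single T" G'] by (simp add: 3)
    have g4: "diamond_basis lam G H =
        linear_extension (\<lambda>Y. basis (forest_append (Single T) Y)) (diamond_basis lam G' H)"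
      using diamond_basis_append_left[of lam "Single T" G' H] by (simp add: 3)
    show ?thesis
      unfolding g3 g4 diamond_linear_extension_left diamond_linear_extension_right g1 g2
      by (rule linear_extension_swap)
  next
    case 4
    have [simp]: "diamond lam (basis (Single Bullet)) x = x"
      "diamond lam x (basis (Single Bullet)) = x" for x
      unfolding diamond_eq_right[of _ _ x] diamond_eq_left[of _ x]
      by (simp_all add: diamond_simps(1))
    from 4 show ?thesis
      by (auto simp: diamond_simps(1))
  next
    case (5 f g h)
    let ?d = "diamond lam" and ?b = basis
    have F: "?b F = graft (?b f)" "?b G = graft (?b g)" "?b H = graft (?b h)"
      by (simp_all add: 5)
    have IH': "?d (?d (?b F') (?b G')) (?b H') = ?d (?b F') (?d (?b G') (?b H'))"
      if "size F' + size G' + size H' < size F + size G + size H" for F' G' H'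
      using IH[OF that] by (simp add: diamond_simps(1))
    note A = diamond_simps(2-5)
    have e: "?d (?d (?b F) (?b G)) (?b h) = ?d (?b F) (?d (?b G) (?b h))"
       "?d (?d (?b F) (?b g)) (?b H) = ?d (?b F) (?d (?b g) (?b H))"
       "?d (?d (?b f) (?b G)) (?b H) = ?d (?b f) (?d (?b G) (?b H))"
       "?d (?d (?b F) (?b g)) (?b h) = ?d (?b F) (?d (?b g) (?b h))"
       "?d (?d (?b f) (?b G)) (?b h) = ?d (?b f) (?d (?b G) (?b h))"
       "?d (?d (?b f) (?b g)) (?b H) = ?d (?b f) (?d (?b g) (?b H))"
       "?d (?d (?b f) (?b g)) (?b h) = ?d (?b f) (?d (?b g) (?b h))"
      by (rule IH'; simp add: 5)+
    define u where "u = ?d (?b F) (?b g) + ?d (?b f) (?b G) + fm_scale lam (?d (?b f) (?b g))"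
    define v where "v = ?d (?b G) (?b h) + ?d (?b g) (?b H) + fm_scale lam (?d (?b g) (?b h))"
    have u: "?d (?b F) (?b G) = graft u" and v: "?d (?b G) (?b H) = graft v"
      unfolding F u_def v_def by (rule diamond_graft)+
    have "?d (?d (?b F) (?b G)) (?b H)
        = graft (?d (?d (?b F) (?b G)) (?b h) + ?d u (?b H) + fm_scale lam (?d u (?b h)))"
      unfolding u unfolding F(3) by (rule diamond_graft)
    also have "?d (?d (?b F) (?b G)) (?b h) + ?d u (?b H) + fm_scale lam (?d u (?b h))
        = ?d (?b F) v + ?d (?b f) (?d (?b G) (?b H)) + fm_scale lam (?d (?b f) v)"
      unfolding u_def v_def A e by (simp only: fm.scale_right_distrib ac_simps)
    also have "graft \<dots> = ?d (?b F) (?d (?b G) (?b H))"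
      unfolding v unfolding F(1) by (rule diamond_graft[symmetric])
    finally have "?d (?d (?b F) (?b G)) (?b H) = ?d (?b F) (?d (?b G) (?b H))" .
    then show ?thesis by (simp add: diamond_simps(1))
  qed
qed

lemma diamond_assoc: "diamond lam (diamond lam x y) z = diamond lam x (diamond lam y z)"
proof -
  have 1: "diamond lam (diamond lam (basis F) (basis G)) (basis H)
      = diamond lam (basis F) (diamond lam (basis G) (basis H))" for F G H
    by (simp add: diamond_simps(1) diamond_basis_assoc)
  have 2: "diamond lam (diamond lam (basis F) (basis G)) (linear_extension basis z)
      = diamond lam (basis F) (diamond lam (basis G) (linear_extension basis z))" for F G
    by (simp only: diamond_linear_extension_right 1)
  have 3: "diamond lam (diamond lam (basis F) (linear_extension basis y)) z
      = diamond lam (basis F) (diamond lam (linear_extension basis y) z)" for F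
    by (simp only: diamond_linear_extension_right diamond_linear_extension_left
        2[unfolded linear_extension_id])
  have "diamond lam (diamond lam (linear_extension basis x) y) z
      = diamond lam (linear_extension basis x) (diamond lam y z)"
    by (simp only: diamond_linear_extension_left 3[unfolded linear_extension_id])
  then show ?thesis by simp
qed

theorem rota_baxter_algebra_forests:
  "rota_baxter_algebra fm_scale (diamond lam) graft lam"
  by unfold_locales (simp_all only: diamond_assoc diamond_simps diamond_graft graft_simps)

end

theory Submission
  imports Defs
begin

text \<open>
  Grafting a forest \<open>H\<close> creates a new ladder \<open>\<lfloor>\<bullet>\<rfloor>\<close> only if \<open>H = \<bullet>\<close>. So \<open>k\<F>\<^sup>0\<close>, from
  whose support \<open>\<bullet>\<close> is excluded, is stable under grafting. For the product, new brackets
  arise only from the recursive equation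
    \<open>\<lfloor>F\<rfloor> \<diamond> \<lfloor>G\<rfloor> = \<lfloor>\<lfloor>F\<rfloor> \<diamond> G\<rfloor> + \<lfloor>F \<diamond> \<lfloor>G\<rfloor>\<rfloor> + \<lambda> \<lfloor>F \<diamond> G\<rfloor>\<close>,
  so it has to be shown that \<open>\<bullet>\<close> occurs in none of the three inner products. This holds because
  \<open>\<bullet>\<close>, which is the identity of \<open>\<diamond>\<close>, cannot be factored nontrivially: it occurs in
  \<open>F \<diamond> G\<close> only for \<open>F = G = \<bullet>\<close> (lemma \<open>bullet_free_diamond_basis\<close>). In the first two inner
  products one factor is a graft, and in the third \<open>F\<close> and \<open>G\<close> differ from \<open>\<bullet>\<close> because
  \<open>\<lfloor>F\<rfloor>\<close> and \<open>\<lfloor>G\<rfloor>\<close> are not ladders.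

  The induction for the product (lemma \<open>ladder_less_diamond_basis\<close>) treats all forests without
  ladders, including \<open>\<bullet>\<close>. The class \<open>\<F>\<^sup>0\<close> would not do, since removing trees from the
  ladder-free forest \<open>\<bullet> \<squnion> G\<close> can leave the excluded forest \<open>\<bullet>\<close>.
\<close>

lemma subspace_free_submodule: "fm.subspace (free_submodule B :: ('b \<Rightarrow>\<^sub>0 'k::comm_ring_1) set)"
proof -
  have "free_submodule B = {x :: 'b \<Rightarrow>\<^sub>0 'k. \<forall>b. b \<notin> B \<longrightarrow> Poly_Mapping.lookup x b = 0}"
    by (auto simp: free_submodule_def in_keys_iff)
  then show ?thesis
    by (simp add: fm.subspace_def lookup_add)
qed

lemma basis_in_free_submodule: "b \<in> B \<Longrightarrow> basis b \<in> free_submodule B"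
  by (simp add: free_submodule_def basis_def)

lemma linear_extension_in_subspace:
  assumes "fm.subspace S" "\<And>b. b \<in> Poly_Mapping.keys x \<Longrightarrow> f b \<in> S"
  shows "linear_extension f x \<in> S"
  unfolding linear_extension_def
  using assms by (intro fm.subspace_sum fm.subspace_scale)

lemma linear_extension_in_free_submodule:
  assumes "x \<in> free_submodule A" "\<And>a. a \<in> A \<Longrightarrow> f a \<in> free_submodule B"
  shows "linear_extension f x \<in> free_submodule B"
  using assms
  by (intro linear_extension_in_subspace subspace_free_submodule) (auto simp: free_submodule_def)

lemma graft_in_free_submodule:
  assumes "x \<in> free_submodule A" "\<And>F. F \<in> A \<Longrightarrow> Single (Graft F) \<in> B"
  shows "graft x \<in> free_submodule B"
  unfolding graft_def
  using assms by (intro linear_extension_in_free_submodule) (auto intro: basis_in_free_submodule)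

lemma diamond_in_free_submodule:
  assumes "x \<in> free_submodule A" "y \<in> free_submodule B"
    and "\<And>F G. F \<in> A \<Longrightarrow> G \<in> B \<Longrightarrow> diamond_basis lam F G \<in> free_submodule C"
  shows "diamond lam x y \<in> free_submodule C"
  unfolding diamond_def bilinear_extension_def
  using assms by (intro linear_extension_in_free_submodule)

lemmas free_submodule_add = fm.subspace_add[OF subspace_free_submodule]
lemmas free_submodule_scale = fm.subspace_scale[OF subspace_free_submodule]

lemma free_submodule_Int: "free_submodule (A \<inter> B) = free_submodule A \<inter> free_submodule B"
  by (auto simp: free_submodule_def)

lemma in_free_submodule_UNIV: "x \<in> free_submodule UNIV"
  by (simp add: free_submodule_def)

lemma has_ladder_forest_append [simp]:
  "has_ladder (forest_append F G) \<longleftrightarrow> has_ladder F \<or> has_ladder G"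
  by (induction F) auto

lemma forest_append_neq_Single [simp]: "forest_append F G \<noteq> Single T"
  by (cases F) auto

text \<open>
  A product of two grafts is a combination of grafts, and a product with a factor of at least
  two trees is a combination of forests of at least two trees. In the remaining case one factor is
  the identity \<open>\<bullet>\<close>, and the product is the other factor.
\<close>

lemma bullet_free_diamond_basis:
  assumes "F \<noteq> Single Bullet \<or> G \<noteq> Single Bullet"
  shows "diamond_basis lam F G \<in> free_submodule {H. H \<noteq> Single Bullet}"
  using assms
proof (induction lam F G rule: diamond_basis.induct)
  case (3 lam F G)
  show ?case
    unfolding diamond_basis.simps
    by (intro free_submodule_add free_submodule_scale
        graft_in_free_submodule[OF in_free_submodule_UNIV]) simp_all
qed (auto intro!: basis_in_free_submodule
      linear_extension_in_free_submodule[OF in_free_submodule_UNIV])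

lemma ladder_less_diamond_basis:
  assumes "\<not> has_ladder F" "\<not> has_ladder G"
  shows "diamond_basis lam F G \<in> free_submodule {H. \<not> has_ladder H}"
  using assms
proof (induction lam F G rule: diamond_basis.induct)
  case (3 lam F G)
  have graft_closed: "graft x \<in> free_submodule {H. \<not> has_ladder H}"
    if "x \<in> free_submodule {H. \<not> has_ladder H}" "x \<in> free_submodule {H. H \<noteq> Single Bullet}"
    for x :: "forest \<Rightarrow>\<^sub>0 'a"
    by (rule graft_in_free_submodule[of _ "{H. \<not> has_ladder H} \<inter> {H. H \<noteq> Single Bullet}"])
      (use that in \<open>auto simp: free_submodule_Int\<close>)
  show ?case
    unfolding diamond_basis.simps
    by (intro free_submodule_add free_submodule_scale graft_closed bullet_free_diamond_basis)
      (use 3 in auto)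
next
  case (4 lam T U G)
  then show ?case
    by (auto intro!: basis_in_free_submodule
        linear_extension_in_free_submodule[of _ "{H. \<not> has_ladder H}"])
next
  case (5 lam T F G)
  then show ?case
    by (auto intro!: basis_in_free_submodule
        linear_extension_in_free_submodule[of _ "{H. \<not> has_ladder H}"])
qed (auto intro!: basis_in_free_submodule)

lemma ladder_free_forests_eq_Int:
  "ladder_free_forests = {H. H \<noteq> Single Bullet} \<inter> {H. \<not> has_ladder H}"
  by (auto simp: ladder_free_forests_def)

theorem proposition2p4:
  fixes lam :: "'k::comm_ring_1"
  shows "nonunitary_rota_baxter_subalgebra fm_scale (diamond lam) graft lam
           (free_submodule ladder_free_forests)"
proof -
  have "diamond lam x y \<in> free_submodule ladder_free_forests"
    if "x \<in> free_submodule ladder_free_forests" "y \<in> free_submodule ladder_free_forests" for x y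
    using that
  proof (rule diamond_in_free_submodule)
    fix F G
    assume "F \<in> ladder_free_forests" "G \<in> ladder_free_forests"
    then show "diamond_basis lam F G \<in> free_submodule ladder_free_forests"
      by (simp add: ladder_free_forests_eq_Int free_submodule_Int
          bullet_free_diamond_basis ladder_less_diamond_basis)
  qed
  moreover have "graft x \<in> free_submodule ladder_free_forests"
    if "x \<in> free_submodule ladder_free_forests" for x :: "forest \<Rightarrow>\<^sub>0 'k"
    using that by (rule graft_in_free_submodule) (simp add: ladder_free_forests_def)
  ultimately show ?thesis
    by (intro nonunitary_rota_baxter_subalgebra.intro rota_baxter_algebra_forests
        nonunitary_rota_baxter_subalgebra_axioms.intro subspace_free_submodule)
qed

end
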